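(* Let $d\ge 2$ be an integer and let $B=[b_{i,j}]\in\mathbb{C}^{d\times d}$ satisfy $\sum_{i=1}^{d}|b_{i,j}|=1$ for every $j=1,2,\ldots,d$. Suppose that the matrix of absolute values $|B|=[|b_{i,j}|]$ is aperiodic and irreducible. Then the sequence of powers $B^n$ converges, as $n\to\infty$, to a nonzero limit matrix that is irreducible if and only if there exist $\xi_1,\xi_2,\ldots,\xi_d\in\mathbb{S}^1$ such that \[ b_{i,j}=|b_{i,j}|\frac{\xi_i}{\xi_j}\qquad\text{for all } i,j=1,2,\ldots,d. \]
   Context: $\mathbb{S}^1=\{z\in\mathbb{C}:|z|=1\}$. Convergence of matrices is entrywise. For a matrix $M=[m_{i,j}]\in\mathbb{C}^{d\times d}$, $|M|$ denotes the matrix $[|m_{i,j}|]$. A matrix $M\in\mathbb{C}^{d\times d}$ is irreducible if the directed graph on $\{1,\ldots,d\}$ with an edge between the ordered pair $(i,j)$ exactly when $m_{i,j}\neq 0$ is strongly connected (equivalently, $|M|$ is irreducible in the usual sense for nonnegative matrices: for all $i,j$ there is $n\ge 1$ with $(|M|^n)_{i,j}>0$). An irreducible nonnegative matrix $A$ is aperiodic if, for every $i$, the greatest common divisor of $\{n\ge 1:(A^n)_{i,i}>0\}$ equals $1$. *)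

theory Defs
  imports
    Complex_Main
    "Jordan_Normal_Form.Matrix"
    "Graph_Theory.Digraph_Component"
    "Graph_Theory.Pair_Digraph"
begin

(* Rows and columns of d x d matrices are indexed by 0, ..., d - 1. *)

definition abs_mat :: "complex mat \<Rightarrow> real mat" where
  "abs_mat M = map_mat cmod M"

definition mat_digraph :: "'a::zero mat \<Rightarrow> nat pair_pre_digraph" where
  "mat_digraph M = \<lparr> pverts = {..<dim_row M},
     parcs = {(i, j). i < dim_row M \<and> j < dim_col M \<and> M $$ (i, j) \<noteq> 0} \<rparr>"

(* strongly_connected uses reflexive reachability. In dimension at least 2 this agrees with
   asking, for all i and j, for a path of length at least 1 from i to j; in dimension 1 it
   would count the zero matrix as irreducible. *)
definition irreducible_mat :: "'a::zero mat \<Rightarrow> bool" where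
  "irreducible_mat M \<longleftrightarrow> square_mat M \<and> strongly_connected (with_proj (mat_digraph M))"

(* Only meaningful for irreducible nonnegative matrices. *)
definition aperiodic_mat :: "real mat \<Rightarrow> bool" where
  "aperiodic_mat A \<longleftrightarrow>
     (\<forall>i < dim_row A. Gcd {n :: nat. 1 \<le> n \<and> (A ^\<^sub>m n) $$ (i, i) > 0} = 1)"

definition mat_tendsto :: "(nat \<Rightarrow> 'a::topological_space mat) \<Rightarrow> 'a mat \<Rightarrow> bool" where
  "mat_tendsto X L \<longleftrightarrow>
     (\<forall>n. X n \<in> carrier_mat (dim_row L) (dim_col L)) \<and>
     (\<forall>i < dim_row L. \<forall>j < dim_col L. (\<lambda>n. X n $$ (i, j)) \<longlonglongrightarrow> L $$ (i, j))"

end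

(* If B^n tends to L, then L B = L, so every row of L is a left fixed vector x of B. Comparing
   |x| with a weighted mean of its entries, the columns of |B| being the weights, shows that |x|
   is maximal at every predecessor of a maximum, hence constant by irreducibility. For a
   nonzero row every triangle inequality in x B = x is then an equality, which gives the phases
   xi i = |x i| / x i. Conversely, B is conjugate to |B| by the diagonal matrix of the phases,
   and the powers of a primitive column-stochastic matrix converge to a positive matrix. *)
theory Submission
  imports Defs
begin

section \<open>Numerical semigroups\<close>

text \<open>The least positive difference \<open>g\<close> of two members of \<open>S\<close>
  divides every member, so it is 1. Hence \<open>S\<close> contains two consecutive numbers
  \<open>b\<close> and \<open>b + 1\<close>, and these generate all large numbers.\<close>

lemma nat_semigroup_cofinite:
  fixes S :: "nat set"
  assumes add: "\<And>a b. a \<in> S \<Longrightarrow> b \<in> S \<Longrightarrow> a + b \<in> S"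
    and Gcd: "Gcd S = 1"
  shows "eventually (\<lambda>n. n \<in> S) sequentially"
proof -
  have mult: "a \<in> S \<Longrightarrow> k > 0 \<Longrightarrow> k * a \<in> S" for a k
  proof (induction k)
    case (Suc k)
    then show ?case by (cases "k = 0") (auto intro: add)
  qed simp
  obtain s where s: "s \<in> S" "s > 0"
    using Gcd by (metis Gcd_0_iff bot_nat_0.not_eq_extremum insertCI subsetI zero_neq_one)
  \<comment> \<open>\<open>P g\<close> says that \<open>g\<close> is a positive difference of two
    members of \<open>S\<close>. The pair \<open>s\<close>, \<open>s + s\<close> shows that such a
    \<open>g\<close> exists even if 0 is not in \<open>S\<close>.\<close>
  define P where "P g \<longleftrightarrow> g > 0 \<and> (\<exists>b \<in> S. b + g \<in> S)" for g
  have "P s" unfolding P_def using s add by auto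
  define g where "g = (LEAST g. P g)"
  have "P g" and least: "\<And>h. P h \<Longrightarrow> g \<le> h"
    unfolding g_def using \<open>P s\<close> by (auto intro: LeastI Least_le)
  then obtain b where b: "b \<in> S" "b + g \<in> S" "g > 0" unfolding P_def by auto
  have "g dvd t" if t: "t \<in> S" for t
  proof (rule ccontr)
    assume "\<not> g dvd t"
    then have r: "t mod g > 0" by (simp add: mod_greater_zero_iff_not_dvd)
    define q where "q = t div g"
    \<comment> \<open>This member and \<open>q * (b + g) + b\<close> differ by exactly
      \<open>t mod g\<close>, a positive difference below \<open>g\<close>. The extra summand
      \<open>b\<close> keeps the second number in \<open>S\<close> when
      \<open>q = 0\<close>.\<close>
    have "t + (q + 1) * b \<in> S"
      using mult[OF b(1), of "q + 1"] t add by auto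
    have eq: "t = q * g + t mod g" unfolding q_def by simp
    have "q * (b + g) + t mod g + b = t + (q + 1) * b"
      by (subst (2) eq) (simp add: algebra_simps)
    then have "(q * (b + g) + b) + t mod g \<in> S" using \<open>t + (q + 1) * b \<in> S\<close> by (simp add: ac_simps)
    moreover have "q * (b + g) + b \<in> S"
      using mult[OF b(2), of q] b(1) add by (cases "q = 0") auto
    ultimately have "P (t mod g)" unfolding P_def using r by blast
    then have "g \<le> t mod g" by (rule least)
    then show False using \<open>g > 0\<close> by (meson mod_less_divisor not_le)
  qed
  then have "g dvd Gcd S" by (rule Gcd_greatest)
  then have "g = 1" using Gcd by simp
  then have b1: "b + 1 \<in> S" using b by simp
  \<comment> \<open>Writing \<open>n = q * b + r\<close>, trade \<open>r\<close> of the
    \<open>q\<close> copies of \<open>b\<close> for copies of \<open>b + 1\<close>. The bound on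
    \<open>n\<close> forces \<open>q > r\<close>, so that a positive number of copies of
    \<open>b\<close> remains.\<close>
  have "n \<in> S" if n: "n \<ge> (b + 1) * (b + 1)" for n
  proof (cases "b = 0")
    case True
    then show ?thesis using mult[OF b1, of n] n by simp
  next
    case False
    define q r where "q = n div b" and "r = n mod b"
    have "r < b" unfolding r_def using False by simp
    have "(b + 1) * b \<le> n" using n by (meson le_add1 mult_le_mono2 order_trans)
    then have "b + 1 \<le> q" unfolding q_def using False by (simp add: less_eq_div_iff_mult_less_eq)
    then have qr: "q - r > 0" "q = (q - r) + r" using \<open>r < b\<close> by auto
    have "n = q * b + r" unfolding q_def r_def by simp
    also have "\<dots> = (q - r) * b + r * (b + 1)"
      by (subst qr(2)) (simp add: algebra_simps)
    finally show ?thesis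
      using mult[OF b(1) qr(1)] mult[OF b1, of r] add by (cases "r = 0") auto
  qed
  then show ?thesis unfolding eventually_sequentially by blast
qed

section \<open>Powers of matrices\<close>

lemma index_mult_mat_sum:
  assumes "A \<in> carrier_mat d d" "B \<in> carrier_mat d d" "i < d" "j < d"
  shows "(A * B) $$ (i, j) = (\<Sum>k<d. A $$ (i, k) * B $$ (k, j))"
  using assms by (auto simp: scalar_prod_def lessThan_atLeast0)

lemma pow_mat_add:
  assumes "A \<in> carrier_mat d d"
  shows "A ^\<^sub>m (m + n) = A ^\<^sub>m m * A ^\<^sub>m n"
proof (induction n)
  case 0
  have "A ^\<^sub>m m \<in> carrier_mat d d" using assms by simp
  then show ?case using assms by simp
next
  case (Suc n)
  then show ?case
    using assoc_mult_mat[OF pow_carrier_mat[OF assms] pow_carrier_mat[OF assms] assms] by simp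
qed

lemma index_pow_mat_add:
  assumes "A \<in> carrier_mat d d" "i < d" "j < d"
  shows "(A ^\<^sub>m (m + n)) $$ (i, j) = (\<Sum>k<d. (A ^\<^sub>m m) $$ (i, k) * (A ^\<^sub>m n) $$ (k, j))"
  using assms by (simp only: pow_mat_add index_mult_mat_sum pow_carrier_mat)

lemma index_pow_mat_Suc:
  assumes "A \<in> carrier_mat d d" "i < d" "j < d"
  shows "(A ^\<^sub>m Suc n) $$ (i, j) = (\<Sum>k<d. (A ^\<^sub>m n) $$ (i, k) * A $$ (k, j))"
  using assms by (simp only: pow_mat.simps index_mult_mat_sum pow_carrier_mat)

lemma pow_mat_nonneg:
  fixes A :: "real mat"
  assumes A: "A \<in> carrier_mat d d"
    and nn: "\<And>i j. i < d \<Longrightarrow> j < d \<Longrightarrow> A $$ (i, j) \<ge> 0"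
    and "i < d" "j < d"
  shows "(A ^\<^sub>m n) $$ (i, j) \<ge> 0"
  using \<open>j < d\<close>
proof (induction n arbitrary: j)
  case 0
  then show ?case using A \<open>i < d\<close> by simp
next
  case (Suc n)
  show ?case unfolding index_pow_mat_Suc[OF A \<open>i < d\<close> Suc.prems]
    using Suc nn by (auto intro!: sum_nonneg)
qed

text \<open>Walks of lengths \<open>m\<close> and \<open>n\<close> through \<open>k\<close>
  concatenate: in the product the summand at \<open>k\<close> is positive and no other summand can
  cancel it.\<close>

lemma pow_mat_pos_add:
  fixes A :: "real mat"
  assumes A: "A \<in> carrier_mat d d"
    and nn: "\<And>i j. i < d \<Longrightarrow> j < d \<Longrightarrow> A $$ (i, j) \<ge> 0"
    and "i < d" "j < d" "k < d"
    and "(A ^\<^sub>m m) $$ (i, k) > 0" "(A ^\<^sub>m n) $$ (k, j) > 0"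
  shows "(A ^\<^sub>m (m + n)) $$ (i, j) > 0"
proof -
  have nn': "\<And>n i j. i < d \<Longrightarrow> j < d \<Longrightarrow> (A ^\<^sub>m n) $$ (i, j) \<ge> 0"
    by (rule pow_mat_nonneg[OF A nn])
  show ?thesis
    unfolding index_pow_mat_add[OF A \<open>i < d\<close> \<open>j < d\<close>]
    using assms nn' by (intro sum_pos2[of _ k]) auto
qed

lemma pow_mat_column_sum:
  fixes A :: "'a::comm_semiring_1 mat"
  assumes A: "A \<in> carrier_mat d d"
    and cs: "\<And>j. j < d \<Longrightarrow> (\<Sum>i<d. A $$ (i, j)) = 1"
    and "j < d"
  shows "(\<Sum>i<d. (A ^\<^sub>m n) $$ (i, j)) = 1"
  using \<open>j < d\<close>
proof (induction n arbitrary: j)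
  case 0
  have "(\<Sum>i<d. (A ^\<^sub>m 0) $$ (i, j)) = (\<Sum>i<d. if i = j then 1 else 0)"
    using A 0 by (intro sum.cong) auto
  then show ?case using 0 by simp
next
  case (Suc n)
  have "(\<Sum>i<d. (A ^\<^sub>m Suc n) $$ (i, j)) = (\<Sum>i<d. \<Sum>k<d. (A ^\<^sub>m n) $$ (i, k) * A $$ (k, j))"
    by (intro sum.cong) (simp_all only: lessThan_iff index_pow_mat_Suc[OF A _ Suc.prems])
  also have "\<dots> = (\<Sum>k<d. (\<Sum>i<d. (A ^\<^sub>m n) $$ (i, k)) * A $$ (k, j))"
    by (subst sum.swap) (simp add: sum_distrib_right)
  also have "\<dots> = (\<Sum>k<d. A $$ (k, j))" using Suc.IH by (intro sum.cong) auto
  finally show ?case using cs[OF Suc.prems] by simp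
qed

text \<open>Translates strong connectivity into a reflexive transitive closure, so that rule
  induction along paths is available.\<close>

lemma irreducible_mat_rtrancl:
  assumes "A \<in> carrier_mat d d" "irreducible_mat A" "i < d" "j < d"
  shows "(i, j) \<in> {(i, j). i < d \<and> j < d \<and> A $$ (i, j) \<noteq> 0}\<^sup>*"
proof -
  have "i \<rightarrow>\<^sup>*\<^bsub>with_proj (mat_digraph A)\<^esub> j"
    using assms unfolding irreducible_mat_def strongly_connected_def
    by (auto simp: mat_digraph_def)
  from reachable_rtranclI[OF this] show ?thesis
    using assms(1) by (simp add: mat_digraph_def)
qed

section \<open>Primitive stochastic matrices\<close>

text \<open>The return times to \<open>i\<close> are closed under addition and have gcd 1, so all
  large numbers are return times. Appending one fixed walk from \<open>i\<close> to \<open>j\<close>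
  gives walks of every large length.\<close>

lemma aperiodic_irreducible_eventually_pos:
  fixes A :: "real mat"
  assumes A: "A \<in> carrier_mat d d"
    and nn: "\<And>i j. i < d \<Longrightarrow> j < d \<Longrightarrow> A $$ (i, j) \<ge> 0"
    and irr: "irreducible_mat A" and aper: "aperiodic_mat A"
  shows "eventually (\<lambda>n. \<forall>i<d. \<forall>j<d. (A ^\<^sub>m n) $$ (i, j) > 0) sequentially"
proof -
  have ev: "eventually (\<lambda>n. (A ^\<^sub>m n) $$ (i, j) > 0) sequentially" if ij: "i < d" "j < d" for i j
  proof -
    have "(i, j) \<in> {(i, j). i < d \<and> j < d \<and> A $$ (i, j) \<noteq> 0}\<^sup>*"
      using irreducible_mat_rtrancl[OF A irr] ij by blast
    \<comment> \<open>The length \<open>p\<close> may be 0, namely when \<open>i = j\<close>; this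
      is harmless because it is only added to a return time.\<close>
    then have "\<exists>p. (A ^\<^sub>m p) $$ (i, j) > 0"
    proof (induction rule: rtrancl_induct)
      case base
      have "(A ^\<^sub>m 0) $$ (i, i) > 0" using A ij by simp
      then show ?case by blast
    next
      case (step k l)
      then obtain p where p: "(A ^\<^sub>m p) $$ (i, k) > 0" by blast
      have "A $$ (k, l) > 0" using step nn[of k l] by force
      then have "(A ^\<^sub>m 1) $$ (k, l) > 0" using A by simp
      with pow_mat_pos_add[OF A nn, where i = i and k = k and j = l] p step ij
      show ?case by blast
    qed
    then obtain p where p: "(A ^\<^sub>m p) $$ (i, j) > 0" by blast
    define S where "S = {n. 1 \<le> n \<and> (A ^\<^sub>m n) $$ (i, i) > 0}"
    have "Gcd S = 1" using aper A ij unfolding aperiodic_mat_def S_def by simp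
    moreover have "a + b \<in> S" if "a \<in> S" "b \<in> S" for a b
      using that pow_mat_pos_add[OF A nn, where i = i and k = i and j = i] ij
      unfolding S_def by auto
    ultimately have "eventually (\<lambda>n. n \<in> S) sequentially"
      by (intro nat_semigroup_cofinite)
    then obtain n0 where n0: "\<And>n. n \<ge> n0 \<Longrightarrow> n \<in> S" unfolding eventually_sequentially by blast
    have "(A ^\<^sub>m n) $$ (i, j) > 0" if "n \<ge> n0 + p" for n
    proof -
      have "n - p \<in> S" using n0 that by simp
      then have "(A ^\<^sub>m (n - p + p)) $$ (i, j) > 0"
        using pow_mat_pos_add[OF A nn, where i = i and k = i and j = j] ij p
        unfolding S_def by blast
      then show ?thesis using that by simp
    qed
    then show ?thesis unfolding eventually_sequentially by blast
  qed
  \<comment> \<open>There are finitely many pairs, so one threshold serves them all.\<close>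
  have "eventually (\<lambda>n. \<forall>i\<in>{..<d}. \<forall>j\<in>{..<d}. (A ^\<^sub>m n) $$ (i, j) > 0) sequentially"
    using ev by (auto intro!: eventually_ball_finite)
  then show ?thesis by (rule eventually_mono) simp
qed

text \<open>The gap between \<open>M\<close> and the mean is the weighted sum of the nonnegative
  gaps \<open>M - x i\<close>, hence at least the term at \<open>k\<close>, whose weight is at least
  \<delta>.\<close>

lemma weighted_mean_le:
  fixes x w :: "'a \<Rightarrow> real"
  assumes "finite I" "(\<Sum>i\<in>I. w i) = 1"
    and w: "\<And>i. i \<in> I \<Longrightarrow> w i \<ge> \<delta>" and "\<delta> \<ge> 0"
    and x: "\<And>i. i \<in> I \<Longrightarrow> x i \<le> M"
    and k: "k \<in> I"
  shows "(\<Sum>i\<in>I. x i * w i) \<le> M - \<delta> * (M - x k)"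
proof -
  have nonneg: "0 \<le> (M - x i) * w i" if "i \<in> I" for i
    using w[OF that] x[OF that] \<open>\<delta> \<ge> 0\<close> by simp
  have "\<delta> * (M - x k) \<le> (M - x k) * w k"
    using w[OF k] x[OF k] by (subst mult.commute) (intro mult_left_mono, auto)
  also have "\<dots> \<le> (\<Sum>i\<in>I. (M - x i) * w i)"
    using nonneg assms(1) k by (intro member_le_sum) auto
  also have "\<dots> = M * (\<Sum>i\<in>I. w i) - (\<Sum>i\<in>I. x i * w i)"
    by (simp add: left_diff_distrib sum_subtractf sum_distrib_left)
  finally show ?thesis using assms(2) by simp
qed

text \<open>Within a row, the columns of a higher power are weighted means of those of a lower one.
  So the maximum of a row decreases along the powers and the minimum increases, and multiplying
  by a positive power contracts their difference by a fixed factor.\<close>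

lemma stochastic_pow_mat_tendsto:
  fixes A :: "real mat"
  assumes A: "A \<in> carrier_mat d d"
    and nn: "\<And>i j. i < d \<Longrightarrow> j < d \<Longrightarrow> A $$ (i, j) \<ge> 0"
    and cs: "\<And>j. j < d \<Longrightarrow> (\<Sum>i<d. A $$ (i, j)) = 1"
    and pos: "\<And>i j. i < d \<Longrightarrow> j < d \<Longrightarrow> (A ^\<^sub>m N) $$ (i, j) > 0"
    and i: "i < d"
  shows "\<exists>l>0. \<forall>j<d. (\<lambda>n. (A ^\<^sub>m n) $$ (i, j)) \<longlonglongrightarrow> l"
proof -
  have nn': "\<And>n i j. i < d \<Longrightarrow> j < d \<Longrightarrow> (A ^\<^sub>m n) $$ (i, j) \<ge> 0"
    by (rule pow_mat_nonneg[OF A nn])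
  have cs': "\<And>n j. j < d \<Longrightarrow> (\<Sum>i<d. (A ^\<^sub>m n) $$ (i, j)) = 1"
    by (rule pow_mat_column_sum[OF A cs])
  define R where "R n = (\<lambda>j. (A ^\<^sub>m n) $$ (i, j)) ` {..<d}" for n
  define U W where "U n = Max (R n)" and "W n = Min (R n)" for n
  have fin: "finite (R n)" and ne: "R n \<noteq> {}" for n
    unfolding R_def using i by auto
  have le_U: "(A ^\<^sub>m n) $$ (i, j) \<le> U n" and W_le: "W n \<le> (A ^\<^sub>m n) $$ (i, j)"
    if "j < d" for n j
    unfolding U_def W_def using that fin by (auto simp: R_def)
  have "U n \<in> R n" "W n \<in> R n" for n
    unfolding U_def W_def using fin ne by (auto intro: Max_in Min_in)
  then have attained: "\<exists>j<d. (A ^\<^sub>m n) $$ (i, j) = U n" "\<exists>j<d. (A ^\<^sub>m n) $$ (i, j) = W n" for n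
    unfolding R_def by (metis (no_types, lifting) imageE lessThan_iff)+

  \<comment> \<open>The weights are column \<open>j\<close> of the \<open>m\<close>-th power, and
    \<open>k\<close> is a column where the row minimum is attained. Taking \<delta> = 0 gives
    monotonicity; a positive \<delta> gives the contraction.\<close>
  have U_contract: "U (n + m) \<le> U n - \<delta> * (U n - W n)"
    if "\<delta> \<ge> 0" "\<And>i j. i < d \<Longrightarrow> j < d \<Longrightarrow> \<delta> \<le> (A ^\<^sub>m m) $$ (i, j)" for n m \<delta>
  proof -
    obtain j where j: "j < d" "(A ^\<^sub>m (n + m)) $$ (i, j) = U (n + m)" using attained by blast
    obtain k where k: "k < d" "(A ^\<^sub>m n) $$ (i, k) = W n" using attained by blast
    have "U (n + m) = (\<Sum>k<d. (A ^\<^sub>m n) $$ (i, k) * (A ^\<^sub>m m) $$ (k, j))"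
      using index_pow_mat_add[OF A i j(1)] j(2) by metis
    also have "\<dots> \<le> U n - \<delta> * (U n - (A ^\<^sub>m n) $$ (i, k))"
      using that j k cs' le_U by (intro weighted_mean_le) auto
    finally show ?thesis using k by simp
  qed
  have W_mono: "W n \<le> W (n + m)" for n m
  proof -
    obtain j where j: "j < d" "(A ^\<^sub>m (n + m)) $$ (i, j) = W (n + m)" using attained by blast
    have "W n = (\<Sum>k<d. W n * (A ^\<^sub>m m) $$ (k, j))"
      using cs'[OF j(1)] by (simp add: sum_distrib_left[symmetric])
    also have "\<dots> \<le> (\<Sum>k<d. (A ^\<^sub>m n) $$ (i, k) * (A ^\<^sub>m m) $$ (k, j))"
      using W_le nn' j by (intro sum_mono mult_right_mono) auto
    also have "\<dots> = W (n + m)"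
      using index_pow_mat_add[OF A i j(1)] j(2) by metis
    finally show ?thesis .
  qed
  have U_mono: "U (n + m) \<le> U n" for n m
    using U_contract[of 0 m n] nn' by simp

  have "decseq U" "incseq W"
    unfolding decseq_def incseq_def using U_mono W_mono by (metis le_iff_add)+
  have W_le_U: "W n \<le> U n" for n
    using W_le[OF i] le_U[OF i] by (rule order_trans)
  have "bdd_below (range U)"
    by (rule bdd_belowI2[of _ "W 0"]) (metis W_mono W_le_U add_0 order_trans)
  then have "\<exists>u. U \<longlonglongrightarrow> u"
    using \<open>decseq U\<close> by (blast intro: LIMSEQ_decseq_INF)
  then obtain u where u: "U \<longlonglongrightarrow> u" ..
  have "bdd_above (range W)"
    by (rule bdd_aboveI2[of _ _ "U 0"]) (metis U_mono W_le_U add_0 order_trans)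
  then have "\<exists>w. W \<longlonglongrightarrow> w"
    using \<open>incseq W\<close> by (blast intro: LIMSEQ_incseq_SUP)
  then obtain w where w: "W \<longlonglongrightarrow> w" ..

  define E where "E = (\<lambda>(i, j). (A ^\<^sub>m N) $$ (i, j)) ` ({..<d} \<times> {..<d})"
  \<comment> \<open>The smallest entry of the \<open>N\<close>-th power, positive as a minimum of
    finitely many positive numbers.\<close>
  define \<delta> where "\<delta> = Min E"
  have E: "finite E" "E \<noteq> {}" unfolding E_def using i by auto
  have "\<delta> > 0"
    unfolding \<delta>_def Min_gr_iff[OF E] using pos by (auto simp: E_def)
  have \<delta>: "\<delta> \<le> (A ^\<^sub>m N) $$ (i, j)" if "i < d" "j < d" for i j
    unfolding \<delta>_def using E(1) that by (intro Min_le) (auto simp: E_def)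
  have "(\<lambda>n. U (n + N)) \<longlonglongrightarrow> u" using u by (rule LIMSEQ_ignore_initial_segment)
  moreover have "(\<lambda>n. U n - \<delta> * (U n - W n)) \<longlonglongrightarrow> u - \<delta> * (u - w)"
    by (intro tendsto_intros u w)
  \<comment> \<open>The contraction inequality in the limit: it forces the limits of the row maxima
    and row minima to coincide.\<close>
  ultimately have "u \<le> u - \<delta> * (u - w)"
    by (rule LIMSEQ_le) (use U_contract[of \<delta> N] \<delta> \<open>\<delta> > 0\<close> in auto)
  then have "u \<le> w" using \<open>\<delta> > 0\<close> by (simp add: mult_le_0_iff)
  moreover have "w \<le> u" by (rule LIMSEQ_le[OF w u]) (use W_le_U in auto)
  ultimately have "u = w" by simp
  have "(\<lambda>n. (A ^\<^sub>m n) $$ (i, j)) \<longlonglongrightarrow> w" if "j < d" for j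
  proof (rule tendsto_sandwich[OF _ _ w])
    show "U \<longlonglongrightarrow> w" using u \<open>u = w\<close> by simp
  qed (use that W_le le_U in auto)
  \<comment> \<open>The row minima increase to \<open>w\<close>, and the one at \<open>N\<close> is
    already positive.\<close>
  moreover have "w > 0"
  proof -
    have "0 < W N" using attained(2)[of N] pos[OF i] by metis
    also have "W N \<le> w" using \<open>incseq W\<close> w by (rule incseq_le)
    finally show ?thesis .
  qed
  ultimately show ?thesis by blast
qed

section \<open>Left fixed vectors and the phases\<close>

text \<open>The equality case of the triangle inequality. After rotation by \<open>cnj u\<close> the
  real parts have the same sum as the moduli, and no real part exceeds its modulus, so each rotated
  term is a nonnegative real.\<close>

lemma norm_sum_eq_imp_aligned:
  fixes z :: "'a \<Rightarrow> complex"
  assumes "finite I" and sum: "(\<Sum>i\<in>I. z i) = complex_of_real r * u" "(\<Sum>i\<in>I. cmod (z i)) = r"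
    and u: "cmod u = 1" and "i \<in> I"
  shows "z i = complex_of_real (cmod (z i)) * u"
proof -
  define t where "t k = z k * cnj u" for k
  have uu: "u * cnj u = 1" using u by (simp add: complex_norm_square[symmetric])
  have norm_t: "cmod (t k) = cmod (z k)" for k using u by (simp add: t_def norm_mult)
  have "(\<Sum>k\<in>I. t k) = complex_of_real r"
    unfolding t_def sum_distrib_right[symmetric] sum by (simp add: mult.assoc uu)
  then have "(\<Sum>k\<in>I. Re (t k)) = r" by (metis Re_complex_of_real Re_sum)
  then have "(\<Sum>k\<in>I. cmod (t k) - Re (t k)) = 0"
    using sum(2) by (simp add: sum_subtractf norm_t)
  then have "\<forall>k\<in>I. cmod (t k) - Re (t k) = 0"
    using \<open>finite I\<close> by (subst (asm) sum_nonneg_eq_0_iff) (auto simp: complex_Re_le_cmod)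
  then have "Re (t i) = cmod (t i)" using \<open>i \<in> I\<close> by simp
  \<comment> \<open>A number whose real part equals its modulus has imaginary part 0.\<close>
  then have "t i = complex_of_real (cmod (z i))"
    unfolding norm_t by (smt (verit) cmod_eq_Re cmod_power2 complex_eqI Im_complex_of_real
        Re_complex_of_real norm_t power2_eq_iff zero_eq_power2)
  then have "t i * u = complex_of_real (cmod (z i)) * u" by simp
  then show ?thesis unfolding t_def by (simp add: mult.assoc mult.commute[of "cnj u"] uu)
qed

lemma left_fixed_vector_cmod_constant:
  fixes B :: "complex mat" and x :: "nat \<Rightarrow> complex"
  assumes B: "B \<in> carrier_mat d d"
    and cs: "\<And>j. j < d \<Longrightarrow> (\<Sum>i<d. cmod (B $$ (i, j))) = 1"
    and irr: "irreducible_mat (abs_mat B)"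
    and fix_x: "\<And>j. j < d \<Longrightarrow> (\<Sum>i<d. x i * B $$ (i, j)) = x j"
  shows "\<exists>c. \<forall>i<d. cmod (x i) = c"
proof (cases "d = 0")
  case False
  define c where "c = Max ((\<lambda>i. cmod (x i)) ` {..<d})"
  have "c \<in> (\<lambda>i. cmod (x i)) ` {..<d}"
    unfolding c_def using False by (intro Max_in) auto
  then obtain m where m: "m < d" "cmod (x m) = c" by auto
  have le: "cmod (x i) \<le> c" if "i < d" for i
    unfolding c_def using that by (intro Max_ge) auto
  have pred: "cmod (x i) = c" if "i < d" "j < d" "B $$ (i, j) \<noteq> 0" "cmod (x j) = c" for i j
  proof -
    \<comment> \<open>The triangle inequality at \<open>j\<close> bounds \<open>c\<close> by a
      weighted mean of moduli that are at most \<open>c\<close>. So each nonnegative term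
      \<open>(c - cmod (x k)) * cmod (B $$ (k, j))\<close> must vanish.\<close>
    have "c \<le> (\<Sum>k<d. cmod (x k) * cmod (B $$ (k, j)))"
      using fix_x[OF that(2)] that(4) norm_sum[of "\<lambda>k. x k * B $$ (k, j)" "{..<d}"]
      by (simp add: norm_mult)
    then have "(\<Sum>k<d. (c - cmod (x k)) * cmod (B $$ (k, j))) \<le> 0"
      using cs[OF that(2)] by (simp add: left_diff_distrib sum_subtractf sum_distrib_left[symmetric])
    moreover have "(c - cmod (x i)) * cmod (B $$ (i, j)) \<le> (\<Sum>k<d. (c - cmod (x k)) * cmod (B $$ (k, j)))"
      using le that(1) by (intro member_le_sum[of i "{..<d}"
            "\<lambda>k. (c - cmod (x k)) * cmod (B $$ (k, j))"]) auto
    ultimately have "(c - cmod (x i)) * cmod (B $$ (i, j)) \<le> 0" by linarith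
    then show ?thesis using le[OF that(1)] that(3) by (auto simp: mult_le_0_iff)
  qed
  have carr: "abs_mat B \<in> carrier_mat d d" using B by (simp add: abs_mat_def)
  \<comment> \<open>Since \<open>pred\<close> moves from the head of an arc to its tail, the
    induction runs backwards along a path from \<open>i\<close> to \<open>m\<close>.\<close>
  have "cmod (x i) = c" if i: "i < d" for i
    using irreducible_mat_rtrancl[OF carr irr i m(1)]
  proof (induction rule: converse_rtrancl_induct)
    case base
    show ?case by (rule m(2))
  next
    case (step k l)
    then show ?case using pred[of k l] B by (auto simp: abs_mat_def)
  qed
  then show ?thesis by blast
qed simp

lemma phases_of_left_fixed_vector:
  fixes B :: "complex mat" and x :: "nat \<Rightarrow> complex"
  assumes B: "B \<in> carrier_mat d d"
    and cs: "\<And>j. j < d \<Longrightarrow> (\<Sum>i<d. cmod (B $$ (i, j))) = 1"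
    and irr: "irreducible_mat (abs_mat B)"
    and fix_x: "\<And>j. j < d \<Longrightarrow> (\<Sum>i<d. x i * B $$ (i, j)) = x j"
    and nz: "k < d" "x k \<noteq> 0"
  shows "\<exists>\<xi> :: nat \<Rightarrow> complex.
            (\<forall>i<d. cmod (\<xi> i) = 1) \<and>
            (\<forall>i<d. \<forall>j<d. B $$ (i, j) = complex_of_real (cmod (B $$ (i, j))) * (\<xi> i / \<xi> j))"
proof -
  obtain c where c: "\<And>i. i < d \<Longrightarrow> cmod (x i) = c"
    using left_fixed_vector_cmod_constant[OF B cs irr fix_x] by blast
  have "c > 0" using c[OF nz(1)] nz(2) by auto
  then have x0: "x i \<noteq> 0" if "i < d" for i using c[OF that] by auto
  define \<xi> where "\<xi> i = complex_of_real c / x i" for i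
  have "cmod (\<xi> i) = 1" if "i < d" for i
    using c[OF that] \<open>c > 0\<close> by (simp add: \<xi>_def norm_divide)
  moreover have "B $$ (i, j) = complex_of_real (cmod (B $$ (i, j))) * (\<xi> i / \<xi> j)"
    if ij: "i < d" "j < d" for i j
  proof -
    have norm: "cmod (x k * B $$ (k, j)) = c * cmod (B $$ (k, j))" if "k < d" for k
      using c[OF that] by (simp add: norm_mult)
    have "(\<Sum>k<d. cmod (x k * B $$ (k, j))) = (\<Sum>k<d. c * cmod (B $$ (k, j)))"
      using norm by (intro sum.cong) auto
    also have "\<dots> = c" using cs[OF ij(2)] by (simp add: sum_distrib_left[symmetric])
    finally have "(\<Sum>k<d. cmod (x k * B $$ (k, j))) = c" .
    \<comment> \<open>The terms \<open>x k * B $$ (k, j)\<close> sum to \<open>x j\<close>, and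
      their moduli sum to \<open>c\<close>, the modulus of \<open>x j\<close>. So all of them point
      in the direction of \<open>x j\<close>; dividing by \<open>x i\<close> produces the quotient
      of phases.\<close>
    then have "x i * B $$ (i, j) = complex_of_real (cmod (x i * B $$ (i, j))) * (x j / complex_of_real c)"
      using fix_x[OF ij(2)] \<open>c > 0\<close> c[OF ij(2)] ij(1)
      by (intro norm_sum_eq_imp_aligned[of "{..<d}" _ c]) (auto simp: norm_divide)
    then have "x i * B $$ (i, j) = complex_of_real (cmod (B $$ (i, j))) * x j"
      using \<open>c > 0\<close> by (simp add: norm[OF ij(1)])
    then show ?thesis
      using x0[OF ij(1)] x0[OF ij(2)] \<open>c > 0\<close> by (simp add: \<xi>_def field_simps)
  qed
  ultimately show ?thesis by blast
qed

section \<open>Limits of powers and conjugation by phases\<close>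

text \<open>Pass to the limit in the recursion that multiplies the \<open>n\<close>-th power by
  \<open>B\<close> on the right; the shifted sequence of powers has the same limit.\<close>

lemma pow_mat_limit_left_fixed:
  fixes B L :: "complex mat"
  assumes B: "B \<in> carrier_mat d d" and L: "L \<in> carrier_mat d d"
    and lim: "mat_tendsto (\<lambda>n. B ^\<^sub>m n) L"
    and ij: "i < d" "j < d"
  shows "(\<Sum>k<d. L $$ (i, k) * B $$ (k, j)) = L $$ (i, j)"
proof -
  have lim': "(\<lambda>n. (B ^\<^sub>m n) $$ (i, j)) \<longlonglongrightarrow> L $$ (i, j)" if "j < d" for j
    using lim L ij(1) that unfolding mat_tendsto_def by auto
  have "(\<lambda>n. (B ^\<^sub>m Suc n) $$ (i, j)) \<longlonglongrightarrow> (\<Sum>k<d. L $$ (i, k) * B $$ (k, j))"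
    unfolding index_pow_mat_Suc[OF B ij] by (intro tendsto_intros lim') auto
  then show ?thesis
    using LIMSEQ_Suc[OF lim'[OF ij(2)]] by (rule LIMSEQ_unique)
qed

text \<open>Conjugation by the diagonal matrix of the phases commutes with taking powers: along a
  walk the quotients of phases telescope, leaving only those of the end points.\<close>

lemma pow_mat_phases:
  fixes B :: "complex mat" and \<xi> :: "nat \<Rightarrow> complex"
  assumes B: "B \<in> carrier_mat d d"
    and \<xi>: "\<And>i. i < d \<Longrightarrow> cmod (\<xi> i) = 1"
    and eq: "\<And>i j. i < d \<Longrightarrow> j < d \<Longrightarrow>
      B $$ (i, j) = complex_of_real (cmod (B $$ (i, j))) * (\<xi> i / \<xi> j)"
    and "i < d" "j < d"
  shows "(B ^\<^sub>m n) $$ (i, j) = complex_of_real ((abs_mat B ^\<^sub>m n) $$ (i, j)) * (\<xi> i / \<xi> j)"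
  using \<open>j < d\<close>
proof (induction n arbitrary: j)
  case 0
  have "\<xi> i \<noteq> 0" using \<xi>[OF \<open>i < d\<close>] by auto
  then show ?case using B 0 \<open>i < d\<close> by (auto simp: abs_mat_def)
next
  case (Suc n)
  have A: "abs_mat B \<in> carrier_mat d d" using B by (simp add: abs_mat_def)
  have "(B ^\<^sub>m n) $$ (i, k) * B $$ (k, j) =
      complex_of_real ((abs_mat B ^\<^sub>m n) $$ (i, k) * abs_mat B $$ (k, j)) * (\<xi> i / \<xi> j)"
    if k: "k < d" for k
  proof -
    have "\<xi> k \<noteq> 0" using \<xi>[OF k] by auto
    moreover have "abs_mat B $$ (k, j) = cmod (B $$ (k, j))"
      using B k Suc.prems by (simp add: abs_mat_def)
    ultimately show ?thesis
      unfolding Suc.IH[OF k] by (subst eq[OF k Suc.prems]) simp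
  qed
  then show ?case
    unfolding index_pow_mat_Suc[OF B \<open>i < d\<close> Suc.prems] index_pow_mat_Suc[OF A \<open>i < d\<close> Suc.prems]
      of_real_sum sum_distrib_right
    by (intro sum.cong) auto
qed

text \<open>Every ordered pair of vertices is joined by an arc. Positivity of \<open>d\<close> is
  there because \<open>strongly_connected\<close> asks for a vertex.\<close>

lemma irreducible_mat_nonzero_entries:
  assumes "L \<in> carrier_mat d d" "d > 0"
    and nz: "\<And>i j. i < d \<Longrightarrow> j < d \<Longrightarrow> L $$ (i, j) \<noteq> 0"
  shows "irreducible_mat L"
proof -
  have "(i, j) \<in> rtrancl_on {..<d} {(i, j). i < d \<and> j < d \<and> L $$ (i, j) \<noteq> 0}"
    if "i < d" "j < d" for i j
    using that nz by (intro rtrancl_on_into_rtrancl_on[OF rtrancl_on_refl]) auto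
  then show ?thesis
    using assms(1,2) unfolding irreducible_mat_def strongly_connected_def
    by (auto simp: mat_digraph_def reachable_def)
qed

theorem theorem1:
  fixes d :: nat and B :: "complex mat"
  assumes "d \<ge> 2"
    and "B \<in> carrier_mat d d"
    and "\<And>j. j < d \<Longrightarrow> (\<Sum>i<d. cmod (B $$ (i, j))) = 1"
    and "irreducible_mat (abs_mat B)"
    and "aperiodic_mat (abs_mat B)"
  shows "(\<exists>L \<in> carrier_mat d d.
            mat_tendsto (\<lambda>n. B ^\<^sub>m n) L \<and> L \<noteq> 0\<^sub>m d d \<and> irreducible_mat L) \<longleftrightarrow>
         (\<exists>\<xi> :: nat \<Rightarrow> complex.
            (\<forall>i<d. cmod (\<xi> i) = 1) \<and>
            (\<forall>i<d. \<forall>j<d. B $$ (i, j) = complex_of_real (cmod (B $$ (i, j))) * (\<xi> i / \<xi> j)))"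
  (is "?lhs \<longleftrightarrow> ?rhs")
proof
  assume ?lhs
  then obtain L where L: "L \<in> carrier_mat d d" "mat_tendsto (\<lambda>n. B ^\<^sub>m n) L" "L \<noteq> 0\<^sub>m d d"
    by blast
  \<comment> \<open>A nonzero entry selects a nonzero row of \<open>L\<close>, which is the left
    fixed vector that yields the phases.\<close>
  obtain i k where ik: "i < d" "k < d" "L $$ (i, k) \<noteq> 0"
    using L(1,3) by (metis carrier_matD eq_matI index_zero_mat)
  show ?rhs
    using assms(2-4) pow_mat_limit_left_fixed[OF assms(2) L(1,2) ik(1)] ik(2,3)
    by (rule phases_of_left_fixed_vector[where x = "\<lambda>k. L $$ (i, k)"])
next
  assume ?rhs
  then obtain \<xi> :: "nat \<Rightarrow> complex" where \<xi>: "\<And>i. i < d \<Longrightarrow> cmod (\<xi> i) = 1"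
    and eq: "\<And>i j. i < d \<Longrightarrow> j < d \<Longrightarrow>
      B $$ (i, j) = complex_of_real (cmod (B $$ (i, j))) * (\<xi> i / \<xi> j)"
    by blast
  define A where "A = abs_mat B"
  have A: "A \<in> carrier_mat d d" and A_index: "\<And>i j. i < d \<Longrightarrow> j < d \<Longrightarrow> A $$ (i, j) = cmod (B $$ (i, j))"
    using assms(2) by (auto simp: A_def abs_mat_def)
  have nn: "\<And>i j. i < d \<Longrightarrow> j < d \<Longrightarrow> A $$ (i, j) \<ge> 0" by (simp add: A_index)
  have cs: "(\<Sum>i<d. A $$ (i, j)) = 1" if "j < d" for j
    using assms(3)[OF that] that by (simp add: A_index)
  obtain N where N: "\<And>i j. i < d \<Longrightarrow> j < d \<Longrightarrow> (A ^\<^sub>m N) $$ (i, j) > 0"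
    using eventually_happens'[OF _ aperiodic_irreducible_eventually_pos[OF A nn]] assms(4,5)
    unfolding A_def by force
  have "\<exists>l>0. \<forall>j<d. (\<lambda>n. (A ^\<^sub>m n) $$ (i, j)) \<longlonglongrightarrow> l" if "i < d" for i
    using A nn cs N that by (rule stochastic_pow_mat_tendsto)
  then obtain l where l: "\<And>i. i < d \<Longrightarrow> l i > 0"
    "\<And>i j. i < d \<Longrightarrow> j < d \<Longrightarrow> (\<lambda>n. (A ^\<^sub>m n) $$ (i, j)) \<longlonglongrightarrow> l i"
    by metis
  \<comment> \<open>The limit of the powers of \<open>A\<close> has all columns equal to
    \<open>l\<close>; \<open>L\<close> is its conjugate by the diagonal matrix of the
    phases.\<close>
  define L where "L = mat d d (\<lambda>(i, j). complex_of_real (l i) * (\<xi> i / \<xi> j))"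
  have L: "L \<in> carrier_mat d d" by (simp add: L_def)
  have \<xi>0: "\<xi> i \<noteq> 0" if "i < d" for i using \<xi>[OF that] by auto
  \<comment> \<open>Positive moduli times unit phases: this gives both irreducibility of
    \<open>L\<close> and \<open>L\<close> being nonzero.\<close>
  have nz: "L $$ (i, j) \<noteq> 0" if "i < d" "j < d" for i j
    using l(1)[OF that(1)] \<xi>0 that by (simp add: L_def)
  have "(\<lambda>n. (B ^\<^sub>m n) $$ (i, j)) \<longlonglongrightarrow> L $$ (i, j)" if ij: "i < d" "j < d" for i j
  proof -
    have "(B ^\<^sub>m n) $$ (i, j) = complex_of_real ((A ^\<^sub>m n) $$ (i, j)) * (\<xi> i / \<xi> j)" for n
      unfolding A_def using assms(2) \<xi> eq ij by (rule pow_mat_phases)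
    moreover have "(\<lambda>n. complex_of_real ((A ^\<^sub>m n) $$ (i, j)) * (\<xi> i / \<xi> j))
        \<longlonglongrightarrow> complex_of_real (l i) * (\<xi> i / \<xi> j)"
      by (intro tendsto_mult_right tendsto_of_real l(2) ij)
    ultimately show ?thesis using ij by (simp add: L_def)
  qed
  then have "mat_tendsto (\<lambda>n. B ^\<^sub>m n) L"
    unfolding mat_tendsto_def using L assms(2) by auto
  moreover have "irreducible_mat L"
    using L nz assms(1) by (intro irreducible_mat_nonzero_entries) auto
  moreover have "L \<noteq> 0\<^sub>m d d"
    using nz[of 0 0] assms(1) by auto
  ultimately show ?lhs using L by blast
qed

end
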